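(* Let $G$ be a finite simple graph with at least one vertex. If $G$ is uniquely colorable, then $G$ is critically $(\chi(G)-1)$-uniform.
   Context: $[k]=\{1,\dots,k\}$ and $\chi(G)$ is the chromatic number of $G$. A coloring of $G=(V,E)$ with $k$ colors is optimal if $k=\chi(G)$. $G$ is uniquely colorable if it has exactly one optimal proper coloring $c:V\to[\chi(G)]$ up to permutation of the colors. For a proper coloring $c:V\to[\chi(G)]$, a determining set for $(G,c)$ is a set $S\subseteq V$ such that for every proper coloring $c':V\to[\chi(G)]$ of $G$, if $c'|_S=c|_S$ then $c'=c$ on all of $V$. A critical set for $(G,c)$ is a determining set for $(G,c)$ that is minimal under inclusion. A critical set of $G$ is a critical set for $(G,c)$ for some proper coloring $c:V\to[\chi(G)]$. $G$ is critically $k$-uniform if every critical set $S\subseteq V$ of $G$ (for every proper coloring $c:V\to[\chi(G)]$) satisfies $|S|=k$. *)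

theory Defs
  imports "Graph_Theory.Digraph" "HOL-Combinatorics.Permutations"
begin

text \<open>
  A finite simple graph is an instance of the locale \<^locale>\<open>graph\<close>, that is, a finite symmetric
  digraph without loops and parallel arcs; an edge \<open>uv\<close> is the pair of arcs \<open>u \<rightarrow> v\<close>, \<open>v \<rightarrow> u\<close>.
  A colouring \<open>V \<rightarrow> [k]\<close> is a total HOL function whose values outside \<open>verts G\<close> are
  irrelevant, so colourings are only ever compared on \<open>verts G\<close>.
\<close>

definition proper_coloring :: "('a, 'b) pre_digraph \<Rightarrow> nat \<Rightarrow> ('a \<Rightarrow> nat) \<Rightarrow> bool" where
  "proper_coloring G k c \<longleftrightarrow>
     c \<in> verts G \<rightarrow> {1..k} \<and> (\<forall>u v. u \<rightarrow>\<^bsub>G\<^esub> v \<longrightarrow> c u \<noteq> c v)"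

definition chromatic_number :: "('a, 'b) pre_digraph \<Rightarrow> nat" where
  "chromatic_number G = (LEAST k. \<exists>c. proper_coloring G k c)"

definition uniquely_colorable :: "('a, 'b) pre_digraph \<Rightarrow> bool" where
  "uniquely_colorable G \<longleftrightarrow>
     (\<exists>c. proper_coloring G (chromatic_number G) c \<and>
       (\<forall>c'. proper_coloring G (chromatic_number G) c' \<longrightarrow>
         (\<exists>\<pi>. \<pi> permutes {1..chromatic_number G} \<and> (\<forall>v\<in>verts G. c' v = \<pi> (c v)))))"

definition determining_set :: "('a, 'b) pre_digraph \<Rightarrow> ('a \<Rightarrow> nat) \<Rightarrow> 'a set \<Rightarrow> bool" where
  "determining_set G c S \<longleftrightarrow>
     S \<subseteq> verts G \<and>
     (\<forall>c'. proper_coloring G (chromatic_number G) c' \<longrightarrow>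
       (\<forall>v\<in>S. c' v = c v) \<longrightarrow> (\<forall>v\<in>verts G. c' v = c v))"

definition critical_set_for :: "('a, 'b) pre_digraph \<Rightarrow> ('a \<Rightarrow> nat) \<Rightarrow> 'a set \<Rightarrow> bool" where
  "critical_set_for G c S \<longleftrightarrow>
     determining_set G c S \<and> (\<forall>T. T \<subset> S \<longrightarrow> \<not> determining_set G c T)"

definition critical_set :: "('a, 'b) pre_digraph \<Rightarrow> 'a set \<Rightarrow> bool" where
  "critical_set G S \<longleftrightarrow>
     (\<exists>c. proper_coloring G (chromatic_number G) c \<and> critical_set_for G c S)"

definition critically_uniform :: "('a, 'b) pre_digraph \<Rightarrow> nat \<Rightarrow> bool" where
  "critically_uniform G k \<longleftrightarrow> (\<forall>S. critical_set G S \<longrightarrow> card S = k)"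

end

(* In an optimal colouring every colour occurs, and in a uniquely colorable graph any two optimal
   colourings differ by a permutation of the colours. A permutation of [k] fixing k - 1 colours is
   the identity, while two colours missing from S can be swapped. So the determining sets are
   exactly the vertex sets that see at least k - 1 colours, and the minimal ones have exactly
   k - 1 elements. *)
theory Submission
  imports Defs
begin

lemma proper_coloring_permute:
  assumes "proper_coloring G k c" "p permutes {1..k}"
  shows "proper_coloring G k (p \<circ> c)"
proof -
  have "(p \<circ> c) v \<in> {1..k}" if "v \<in> verts G" for v
    using assms that permutes_in_image[OF assms(2)] unfolding proper_coloring_def by force
  then show ?thesis
    using assms permutes_inj[OF assms(2)] unfolding proper_coloring_def
    by (auto simp: inj_eq)
qed

lemma optimal_coloring_surj:
  assumes c: "proper_coloring G (chromatic_number G) c"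
  shows "c ` verts G = {1..chromatic_number G}"
proof (rule ccontr)
  let ?k = "chromatic_number G"
  assume "c ` verts G \<noteq> {1..?k}"
  moreover have "c ` verts G \<subseteq> {1..?k}"
    using c unfolding proper_coloring_def by auto
  ultimately obtain j where j: "j \<in> {1..?k}" "j \<notin> c ` verts G" by blast
  define d where "d = transpose j ?k \<circ> c"
  have "transpose j ?k permutes {1..?k}"
    using j by (intro permutes_swap_id) auto
  then have d: "proper_coloring G ?k d"
    unfolding d_def using c by (rule proper_coloring_permute[rotated])
  have "d v \<in> {1..?k - 1}" if "v \<in> verts G" for v
  proof -
    have "c v \<noteq> j" using that j by blast
    then have "d v \<noteq> ?k" by (auto simp: d_def transpose_def)
    moreover have "d v \<in> {1..?k}" using d that unfolding proper_coloring_def by blast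
    ultimately show ?thesis by auto
  qed
  then have "proper_coloring G (?k - 1) d"
    using d unfolding proper_coloring_def by blast
  \<comment> \<open>Subtraction is truncated, so this is absurd only for positive \<open>?k\<close>;
    the colour \<open>j\<close> in \<open>{1..?k}\<close> guarantees that.\<close>
  then have "?k \<le> ?k - 1"
    unfolding chromatic_number_def by (metis (mono_tags, lifting) Least_le)
  then show False using j by auto
qed

text \<open>The definition compares every optimal colouring with one reference colouring
  \<open>c0\<close>. Passing from \<open>c\<close> back to \<open>c0\<close> and on to
  \<open>c'\<close> makes the comparison available for any pair.\<close>

lemma uniquely_colorable_permutes:
  assumes "uniquely_colorable G"
    and "proper_coloring G (chromatic_number G) c"
    and "proper_coloring G (chromatic_number G) c'"
  obtains p where "p permutes {1..chromatic_number G}" "\<And>v. v \<in> verts G \<Longrightarrow> c' v = p (c v)"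
proof -
  obtain c0 where c0: "\<And>d. proper_coloring G (chromatic_number G) d \<Longrightarrow>
      \<exists>p. p permutes {1..chromatic_number G} \<and> (\<forall>v\<in>verts G. d v = p (c0 v))"
    using assms(1) unfolding uniquely_colorable_def by blast
  obtain p q where p: "p permutes {1..chromatic_number G}" "\<forall>v\<in>verts G. c v = p (c0 v)"
    and q: "q permutes {1..chromatic_number G}" "\<forall>v\<in>verts G. c' v = q (c0 v)"
    using c0[OF assms(2)] c0[OF assms(3)] by blast
  show thesis
  proof
    show "q \<circ> inv p permutes {1..chromatic_number G}"
      by (intro permutes_compose permutes_inv p q)
    show "c' v = (q \<circ> inv p) (c v)" if "v \<in> verts G" for v
      using p q that by (simp add: permutes_inverses)
  qed
qed

text \<open>Used with \<open>A\<close> the set of colours not occurring on \<open>S\<close>: with at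
  most one point free to move, nothing moves.\<close>

lemma permutes_card_le_1:
  assumes "p permutes A" "finite A" "card A \<le> 1"
  shows "p = id"
proof -
  have "\<exists>a. A \<subseteq> {a}"
    using assms(2,3) by (auto simp: le_Suc_eq card_1_singleton_iff)
  then obtain a where "A \<subseteq> {a}" ..
  then have "p permutes {a}"
    using permutes_subset[OF assms(1)] by blast
  then show ?thesis
    by simp
qed

lemma determining_set_iff:
  assumes "uniquely_colorable G"
    and c: "proper_coloring G (chromatic_number G) c"
    and S: "S \<subseteq> verts G"
  shows "determining_set G c S \<longleftrightarrow> chromatic_number G - 1 \<le> card (c ` S)"
proof -
  let ?k = "chromatic_number G"
  have sub: "c ` S \<subseteq> {1..?k}"
    using optimal_coloring_surj[OF c] S by blast
  \<comment> \<open>Both directions count the unseen colours: two of them can be swapped, while at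
    most one forces the identity.\<close>
  have card: "card ({1..?k} - c ` S) = ?k - card (c ` S)"
    using sub by (simp add: card_Diff_subset finite_subset)
  show ?thesis
  proof
    assume det: "determining_set G c S"
    show "?k - 1 \<le> card (c ` S)"
    proof (rule ccontr)
      assume "\<not> ?k - 1 \<le> card (c ` S)"
      then have "\<not> card ({1..?k} - c ` S) \<le> Suc 0"
        using card by linarith
      then obtain a b where ab: "a \<in> {1..?k} - c ` S" "b \<in> {1..?k} - c ` S" "a \<noteq> b"
        by (auto simp: card_le_Suc0_iff_eq)
      have "proper_coloring G ?k (transpose a b \<circ> c)"
        using ab by (intro proper_coloring_permute[OF c] permutes_swap_id) auto
      moreover have "\<forall>v\<in>S. (transpose a b \<circ> c) v = c v"
        using ab by (auto simp: transpose_def)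
      ultimately have eq: "\<forall>v\<in>verts G. (transpose a b \<circ> c) v = c v"
        using det unfolding determining_set_def by blast
      \<comment> \<open>The swap must really change the colouring: by optimality some vertex has
        colour \<open>a\<close>, and it is recoloured to \<open>b\<close>.\<close>
      have "a \<in> c ` verts G"
        using ab optimal_coloring_surj[OF c] by simp
      then obtain v where "v \<in> verts G" "c v = a" by blast
      then show False using eq ab by auto
    qed
  next
    assume le: "?k - 1 \<le> card (c ` S)"
    have "\<forall>v\<in>verts G. c' v = c v"
      if c': "proper_coloring G ?k c'" and agree: "\<forall>v\<in>S. c' v = c v" for c'
    proof -
      obtain p where p: "p permutes {1..?k}" "\<And>v. v \<in> verts G \<Longrightarrow> c' v = p (c v)"
        using uniquely_colorable_permutes[OF assms(1) c c'] by blast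
      have "p x = x" if "x \<in> c ` S" for x
        using that agree p(2) S by force
      \<comment> \<open>Since \<open>p\<close> fixes every colour seen on \<open>S\<close>, it can
        only move unseen ones.\<close>
      then have "p permutes {1..?k} - c ` S"
        using p(1) by (auto intro: permutes_superset)
      then have "p = id"
        by (rule permutes_card_le_1) (use card le in auto)
      then show ?thesis using p by simp
    qed
    then show "determining_set G c S"
      using S unfolding determining_set_def by blast
  qed
qed

theorem proposition1:
  fixes G :: "('a, 'b) pre_digraph"
  assumes "graph G"
    and "verts G \<noteq> {}"
    and "uniquely_colorable G"
  shows "critically_uniform G (chromatic_number G - 1)"
  unfolding critically_uniform_def
proof (intro allI impI)
  fix S
  let ?k = "chromatic_number G"
  assume "critical_set G S"
  then obtain c where c: "proper_coloring G ?k c" and det: "determining_set G c S"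
    and min: "\<And>T. T \<subset> S \<Longrightarrow> \<not> determining_set G c T"
    unfolding critical_set_def critical_set_for_def by blast
  have S: "S \<subseteq> verts G" using det unfolding determining_set_def by blast
  have "?k - 1 \<le> card (c ` S)"
    using det determining_set_iff[OF assms(3) c S] by blast
  then obtain C where C: "C \<subseteq> c ` S" "card C = ?k - 1"
    by (meson obtain_subset_with_card_n)
  \<comment> \<open>\<open>T\<close> picks one vertex of \<open>S\<close> for each colour in
    \<open>C\<close>, so it has \<open>?k - 1\<close> elements and still sees enough colours to be
    determining.\<close>
  then obtain T where T: "T \<subseteq> S" "inj_on c T" "C = c ` T"
    by (meson subset_image_inj)
  have "determining_set G c T"
    using determining_set_iff[OF assms(3) c, of T] T C S by auto
  \<comment> \<open>By minimality \<open>S\<close> is itself such a set of representatives, hence as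
    large as \<open>C\<close>.\<close>
  then have "T = S" using min T by blast
  then show "card S = ?k - 1"
    using T C card_image by metis
qed

end
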